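(* Let $\mathcal{M}$ be a weakly bounded moment functional, let $p<1$ be as in the definition of weak boundedness, let $f(z)$ be a function analytic on a domain $G\subseteq\mathbb{C}$, and let $u\in G$. (1) If the sequence $|f^{(n)}(u)/n!^{1-p}|^{1/n}$ is bounded, then the chromatic expansion $\mathrm{CE}^{\mathcal{M}}[f,u](z)$ of $f(z)$ converges uniformly to $f(z)$ on a disc $D\subseteq G$ centered at $u$. (2) In particular, if $|f^{(n)}(u)/n!^{1-p}|^{1/n}$ converges to zero, then the chromatic expansion $\mathrm{CE}^{\mathcal{M}}[f,u](z)$ of $f(z)$ converges for all $z\in G$, and the convergence is uniform on every closed disc around $u$ contained in $G$.
   Context: $\mathcal{M}$ is a linear functional on real polynomials in $\omega$, normalized by $\mathcal{M}(1)=1$, with orthonormal polynomials $P_n^{\mathcal M}$ ($\mathcal{M}(P_n^{\mathcal M}P_m^{\mathcal M})=\delta(m-n)$) satisfying, for some reals $\gamma_n>0$, $P_{n+1}^{\mathcal M}(\omega)=\frac{\omega}{\gamma_n}P_n^{\mathcal M}(\omega)-\frac{\gamma_{n-1}}{\gamma_n}P_{n-1}^{\mathcal M}(\omega)$ for all $n\ge0$, with $P_0^{\mathcal M}=1$, $P_{-1}^{\mathcal M}=0$, $\gamma_{-1}=1$. $\mathcal{M}$ is weakly bounded if there exist $M\ge1$, $0\le p<1$ and an integer $r\ge0$ such that for all $n\ge0$: $\frac1M\le\gamma_n\le M(n+r)^p$ and $\frac{\gamma_n}{\gamma_{n+1}}\le M^2$. $a(\omega)$ is a non-decreasing bounded function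 with $\int_{-\infty}^{\infty}\omega^n\,da(\omega)=\mathcal{M}(\omega^n)$ for all $n$, and $\mathbf{m}(z)=\int_{-\infty}^{\infty}e^{i\omega z}\,da(\omega)$, which is an entire function when $\mathcal{M}$ is weakly bounded. The chromatic derivatives are $\mathcal{K}^n=i^{-n}P_n^{\mathcal{M}}(iD)$, $D$ being differentiation (each $\omega^k$ in $P_n^{\mathcal M}(\omega)$ is replaced by $i^kD^k$). The chromatic expansion of $f$ centered at $u$ is the series $\mathrm{CE}^{\mathcal{M}}[f,u](z)=\sum_{k=0}^{\infty}(-1)^k\mathcal{K}^k[f](u)\,\mathcal{K}^k[\mathbf{m}](z-u)$. *)

theory Defs
  imports "HOL-Complex_Analysis.Complex_Analysis"
    "HOL-Computational_Algebra.Polynomial"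
begin

text \<open>
  A normalized moment functional on real polynomials, together with its orthonormal
  polynomials \<open>P\<close> and the coefficients \<open>\<gamma>\<close> of their three-term recurrence. The case
  \<open>n = 0\<close> is split off because of the convention \<open>P\<^sub>-\<^sub>1 = 0\<close>.
\<close>
locale moment_functional =
  fixes \<M> :: "real poly \<Rightarrow> real" and P :: "nat \<Rightarrow> real poly" and \<gamma> :: "nat \<Rightarrow> real"
  assumes linear: "Vector_Spaces.linear smult (*) \<M>"
    and normalized: "\<M> 1 = 1"
    and orthonormal: "\<And>m n. \<M> (P n * P m) = (if m = n then 1 else 0)"
    and gamma_pos: "\<And>n. \<gamma> n > 0"
    and P_0: "P 0 = 1"
    and P_Suc: "\<And>n. P (Suc n) = smult (1 / \<gamma> n) ([:0, 1:] * P n)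
                  - (if n = 0 then 0 else smult (\<gamma> (n - 1) / \<gamma> n) (P (n - 1)))"

text \<open>
  Weak boundedness with a prescribed exponent \<open>p\<close>. Since \<open>0 powr 0 = 0\<close> in HOL, the
  bound below is unsatisfiable for \<open>r = 0\<close>. Under the convention \<open>0\<^sup>0 = 1\<close> it would be
  satisfiable for \<open>r = 0\<close> only when \<open>p = 0\<close>; as \<open>r\<close> is existentially quantified, one may then
  take \<open>r = 1\<close>, so the two conventions define the same predicate.
\<close>
definition weakly_bounded :: "(nat \<Rightarrow> real) \<Rightarrow> real \<Rightarrow> bool" where
  "weakly_bounded \<gamma> p \<longleftrightarrow> 0 \<le> p \<and> p < 1 \<and>
     (\<exists>M\<ge>1. \<exists>r::nat. \<forall>n. 1 / M \<le> \<gamma> n \<and> \<gamma> n \<le> M * real (n + r) powr p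
                       \<and> \<gamma> n / \<gamma> (Suc n) \<le> M\<^sup>2)"

text \<open>
  The Lebesgue--Stieltjes measure of a non-decreasing function. \<^const>\<open>interval_measure\<close> is
  only meaningful for right-continuous functions, so we pass to right limits; this does not
  affect integrals of continuous functions against \<open>da\<close>.
\<close>
definition stieltjes_measure :: "(real \<Rightarrow> real) \<Rightarrow> real measure" where
  "stieltjes_measure a = interval_measure (\<lambda>x. Lim (at_right x) a)"

definition moment_distribution :: "(real poly \<Rightarrow> real) \<Rightarrow> (real \<Rightarrow> real) \<Rightarrow> bool" where
  "moment_distribution \<M> a \<longleftrightarrow> mono a \<and> bounded (range a) \<and>
     (\<forall>n. has_bochner_integral (stieltjes_measure a) (\<lambda>\<omega>. \<omega> ^ n) (\<M> (monom 1 n)))"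

definition fourier_transform :: "(real \<Rightarrow> real) \<Rightarrow> complex \<Rightarrow> complex" where
  "fourier_transform a z = (LINT \<omega>|stieltjes_measure a. exp (\<i> * of_real \<omega> * z))"

definition chromatic_derivative ::
  "(nat \<Rightarrow> real poly) \<Rightarrow> nat \<Rightarrow> (complex \<Rightarrow> complex) \<Rightarrow> complex \<Rightarrow> complex" where
  "chromatic_derivative P n f z =
     inverse \<i> ^ n * (\<Sum>k\<le>degree (P n). of_real (coeff (P n) k) * \<i> ^ k * (deriv ^^ k) f z)"

definition chromatic_term ::
  "(nat \<Rightarrow> real poly) \<Rightarrow> (real \<Rightarrow> real) \<Rightarrow> (complex \<Rightarrow> complex) \<Rightarrow> complex \<Rightarrow> nat \<Rightarrow> complex \<Rightarrow> complex"
where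
  "chromatic_term P a f u k z =
     (-1) ^ k * chromatic_derivative P k f u * chromatic_derivative P k (fourier_transform a) (z - u)"

text \<open>
  The sequence of the numbers \<open>|f\<^sup>(\<^sup>n\<^sup>)(u) / n!\<^sup>1\<^sup>-\<^sup>p|\<^sup>1\<^sup>/\<^sup>n\<close>. Its irrelevant entry at \<open>n = 0\<close> is 0,
  because \<open>root 0 x = 0\<close>.
\<close>
definition root_sequence :: "real \<Rightarrow> (complex \<Rightarrow> complex) \<Rightarrow> complex \<Rightarrow> nat \<Rightarrow> real" where
  "root_sequence p f u n = root n (cmod ((deriv ^^ n) f u / of_real (fact n powr (1 - p))))"

end

theory Submission
  imports Defs "HOL-Real_Asymp.Real_Asymp"
begin

text \<open>
  Let \<open>b\<^sub>j\<^sub>k = \<M>(\<omega>\<^sup>j P\<^sub>k)\<close>, so that \<open>\<omega>\<^sup>j = \<Sum>\<^sub>k\<^sub>\<le>\<^sub>j b\<^sub>j\<^sub>k P\<^sub>k\<close>, and let \<open>m\<close> be the Fourier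
  transform of \<open>da\<close>. The Taylor coefficients of the \<open>k\<close>-th chromatic derivative of \<open>m\<close> at 0
  are \<open>i\<^sup>j\<^sup>+\<^sup>k b\<^sub>j\<^sub>k\<close>, which vanish for \<open>j < k\<close>. Hence each Taylor coefficient of the chromatic
  expansion at \<open>u\<close> is a finite sum, and the expansion of \<open>\<omega>\<^sup>j\<close> in the \<open>P\<^sub>k\<close> shows that it equals
  that of \<open>f\<close>. The recurrence gives, for some \<open>L \<ge> 1\<close>, \<open>|b\<^sub>j\<^sub>k| \<le> (2L)\<^sup>j j!\<^sup>p\<close> and bounds the coefficients of \<open>P\<^sub>k\<close> by
  \<open>(2L)\<^sup>k\<close>. The hypothesis \<open>|f\<^sup>(\<^sup>n\<^sup>)(u)| \<le> K B\<^sup>n n!\<^sup>1\<^sup>-\<^sup>p\<close> supplies the complementary power of the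
  factorial, so the double series is dominated by a geometric series whose ratio is
  proportional to \<open>B |z - u|\<close>; if the root sequence tends to 0, then \<open>B\<close> may be taken arbitrarily small.
\<close>

section \<open>Termwise differentiation of everywhere convergent exponential series\<close>

lemma sums_deriv_exponential_series:
  fixes c :: "nat \<Rightarrow> complex"
  assumes "\<And>w. (\<lambda>n. c n * w ^ n / fact n) sums h w"
  shows "(h has_field_derivative deriv h w) (at w)"
    and "(\<lambda>n. c (Suc n) * w ^ n / fact n) sums deriv h w"
proof -
  define d where "d n = c n / fact n" for n
  have sm: "summable (\<lambda>n. d n * w ^ n)" for w
    using assms[of w] by (simp add: d_def sums_iff)
  have h: "h = (\<lambda>w. \<Sum>n. d n * w ^ n)"
    using assms by (simp add: d_def sums_iff fun_eq_iff)
  have D: "DERIV h w :> (\<Sum>n. diffs d n * w ^ n)" for w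
    unfolding h by (rule termdiffs_strong_converges_everywhere) (rule sm)
  then show "(h has_field_derivative deriv h w) (at w)"
    by (metis DERIV_imp_deriv)
  have "summable (\<lambda>n. diffs d n * w ^ n)"
    by (rule termdiff_converges_all) (rule sm)
  then have "(\<lambda>n. diffs d n * w ^ n) sums deriv h w"
    unfolding DERIV_imp_deriv[OF D] by (rule summable_sums)
  \<comment> \<open>With the factorial in the denominator, the factor produced by
    \<open>diffs\<close> cancels, so differentiation merely shifts the sequence \<open>c\<close>;
    this makes iteration trivial.\<close>
  moreover have "diffs d n * w ^ n = c (Suc n) * w ^ n / fact n" for n
    by (simp add: diffs_def d_def field_simps del: of_nat_Suc)
  ultimately show "(\<lambda>n. c (Suc n) * w ^ n / fact n) sums deriv h w"
    by simp
qed

lemma sums_higher_deriv_exponential_series: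
  fixes c :: "nat \<Rightarrow> complex"
  assumes "\<And>w. (\<lambda>n. c n * w ^ n / fact n) sums h w"
  shows "(\<lambda>n. c (n + k) * w ^ n / fact n) sums (deriv ^^ k) h w"
  using assms
proof (induction k arbitrary: c h w)
  case (Suc k)
  have "(\<lambda>n. c (Suc (n + k)) * w ^ n / fact n) sums (deriv ^^ k) (deriv h) w"
    using Suc.IH[of "\<lambda>n. c (Suc n)" "deriv h"] sums_deriv_exponential_series(2)[OF Suc.prems] by simp
  then show ?case by (simp add: funpow_swap1)
qed simp

section \<open>Growth of geometric sequences weighted by powers of the factorial\<close>

lemma eventually_increasing_dominates_past:
  fixes s :: "nat \<Rightarrow> real"
  assumes pos: "\<And>k. s k > 0" and inc: "\<forall>\<^sub>F k in sequentially. s k \<le> s (Suc k)"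
  obtains c where "c > 0" "\<And>j k. j \<le> k \<Longrightarrow> s j \<le> c * s k"
proof -
  obtain n0 where n0: "\<And>k. k \<ge> n0 \<Longrightarrow> s k \<le> s (Suc k)"
    using inc by (auto simp: eventually_sequentially)
  have mono: "s j \<le> s k" if "n0 \<le> j" "j \<le> k" for j k
    using that(2)
  proof (induction k rule: dec_induct)
    case (step m)
    then show ?case using n0[of m] that(1) by linarith
  qed simp
  \<comment> \<open>The double sum controls every ratio with both indices up to \<open>n0\<close>,
    where nothing is known about monotonicity. The summand 1 gives \<open>c \<ge> 1\<close>, enough
    beyond \<open>n0\<close>; pairs straddling \<open>n0\<close> are compared through
    \<open>s n0\<close>.\<close>
  define c where "c = 1 + (\<Sum>i\<le>n0. \<Sum>l\<le>n0. s i / s l)"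
  have nn: "s i / s l \<ge> 0" for i l
    using pos by (simp add: less_imp_le)
  have c1: "c \<ge> 1"
    unfolding c_def by (simp add: sum_nonneg nn)
  have small: "s j \<le> c * s k" if "j \<le> n0" "k \<le> n0" for j k
  proof -
    have "s j / s k \<le> (\<Sum>l\<le>n0. s j / s l)"
      by (rule member_le_sum[of k "{..n0}" "\<lambda>l. s j / s l"]) (use that nn in auto)
    also have "\<dots> \<le> (\<Sum>i\<le>n0. \<Sum>l\<le>n0. s i / s l)"
      by (rule member_le_sum[of j "{..n0}" "\<lambda>i. \<Sum>l\<le>n0. s i / s l"])
        (use that nn in \<open>auto intro: sum_nonneg\<close>)
    finally show ?thesis
      using pos[of k] by (simp add: c_def field_simps)
  qed
  have "s j \<le> c * s k" if "j \<le> k" for j k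
  proof -
    consider "k \<le> n0" | "n0 \<le> j" | "j \<le> n0" "n0 \<le> k" by linarith
    then show ?thesis
    proof cases
      case 2
      then have "s j \<le> 1 * s k" using mono that by simp
      also have "\<dots> \<le> c * s k" using c1 pos[of k] by (intro mult_right_mono) auto
      finally show ?thesis .
    next
      case 3
      then have "s j \<le> c * s n0" using small by blast
      also have "\<dots> \<le> c * s k" using c1 mono 3 by (intro mult_left_mono) auto
      finally show ?thesis .
    qed (use small that in auto)
  qed
  with c1 show thesis by (intro that[of c]) auto
qed

text \<open>Consecutive terms have quotient \<open>B * real (Suc k) powr q\<close>, which tends to
  infinity. For \<open>B < 1\<close> the sequence decreases at first, hence the constant
  \<open>c\<close>. It allows bounds on all lower derivatives to be replaced by the bound at the top
  order.\<close>

lemma power_fact_powr_dominates_past: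
  fixes B q :: real
  assumes "B > 0" "q > 0"
  obtains c where "c > 0"
    "\<And>j k. j \<le> k \<Longrightarrow> B ^ j * fact j powr q \<le> c * (B ^ k * fact k powr q)"
proof (rule eventually_increasing_dominates_past[of "\<lambda>k. B ^ k * fact k powr q"])
  have "filterlim (\<lambda>k. B * real (Suc k) powr q) at_top sequentially"
    using assms by real_asymp
  then have "\<forall>\<^sub>F k in sequentially. 1 \<le> B * real (Suc k) powr q"
    by (simp add: filterlim_at_top)
  then show "\<forall>\<^sub>F k in sequentially. B ^ k * fact k powr q \<le> B ^ Suc k * fact (Suc k) powr q"
  proof eventually_elim
    case (elim k)
    have "B ^ k * fact k powr q * 1 \<le> B ^ k * fact k powr q * (B * real (Suc k) powr q)"
      using elim assms by (intro mult_left_mono) auto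
    then show ?case
      by (simp add: powr_mult mult_ac del: of_nat_Suc)
  qed
qed (use assms in auto)

text \<open>Domination of the term at index 0 makes \<open>fact n powr (- q)\<close> at most a
  constant times \<open>B ^ n\<close> for any positive \<open>B\<close>; a \<open>B\<close> with
  \<open>x * B < 1\<close> leaves a geometric majorant.\<close>

lemma summable_power_over_fact_powr:
  fixes x q :: real
  assumes "x \<ge> 0" "q > 0"
  shows "summable (\<lambda>n. x ^ n * fact n powr (- q))"
proof -
  define B where "B = 1 / (2 * (x + 1))"
  have B: "B > 0" "x * B < 1" using assms by (auto simp: B_def field_simps)
  obtain c where c: "c > 0"
    and le: "\<And>j k. j \<le> k \<Longrightarrow> B ^ j * fact j powr q \<le> c * (B ^ k * fact k powr q)"
    using power_fact_powr_dominates_past[OF B(1) \<open>q > 0\<close>] by blast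
  show ?thesis
  proof (rule summable_comparison_test)
    show "\<exists>N. \<forall>n\<ge>N. norm (x ^ n * fact n powr (- q)) \<le> c * (x * B) ^ n"
    proof (intro exI allI impI)
      fix n
      have "fact n powr (- q) \<le> c * B ^ n"
        using le[of 0 n] by (simp add: powr_minus field_simps)
      then have "x ^ n * fact n powr (- q) \<le> x ^ n * (c * B ^ n)"
        using assms by (intro mult_left_mono) auto
      then show "norm (x ^ n * fact n powr (- q)) \<le> c * (x * B) ^ n"
        using assms by (simp add: abs_mult power_mult_distrib mult_ac)
    qed
    show "summable (\<lambda>n. c * (x * B) ^ n)"
      using B assms by (intro summable_mult summable_geometric) auto
  qed
qed

text \<open>Beyond \<open>N\<close> the \<open>n\<close>-th power of the root bound is the claim,
  and \<open>K\<close> absorbs the finitely many earlier indices. Index 0 is always among them, as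
  \<open>root 0\<close> carries no information.\<close>

lemma root_sequence_bound:
  assumes "\<forall>\<^sub>F n in sequentially. root_sequence p f u n \<le> B" "B > 0"
  obtains K where "K > 0" "\<And>n. cmod ((deriv ^^ n) f u) \<le> K * (B ^ n * fact n powr (1 - p))"
proof -
  obtain N where N: "\<And>n. n \<ge> N \<Longrightarrow> root_sequence p f u n \<le> B"
    using assms(1) by (auto simp: eventually_sequentially)
  define t where "t n = B ^ n * fact n powr (1 - p)" for n
  have t: "t n > 0" for n using assms(2) by (simp add: t_def)
  define F where "F n = cmod ((deriv ^^ n) f u)" for n
  define K where "K = 1 + (\<Sum>n\<le>N. F n / t n)"
  have nn: "F n / t n \<ge> 0" for n using t[of n] by (simp add: F_def)
  have K1: "K \<ge> 1" unfolding K_def by (simp add: sum_nonneg nn)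
  have "F n \<le> K * t n" for n
  proof (cases "n \<le> N")
    case True
    then have "F n / t n \<le> (\<Sum>n\<le>N. F n / t n)"
      by (intro member_le_sum) (use nn in auto)
    then show ?thesis using t[of n] by (simp add: K_def field_simps)
  next
    case False
    define r where "r = F n / fact n powr (1 - p)"
    have "root n r \<le> B"
      using N[of n] False by (simp add: root_sequence_def r_def F_def norm_divide)
    moreover have "0 \<le> r" by (simp add: r_def F_def)
    ultimately have "root n r ^ n \<le> B ^ n"
      by (intro power_mono real_root_ge_zero) auto
    moreover have "root n r ^ n = r"
      using False \<open>0 \<le> r\<close> by (intro real_root_pow_pos2) auto
    ultimately have "r \<le> B ^ n" by simp
    then have "F n \<le> 1 * t n" by (simp add: r_def t_def field_simps)
    also have "\<dots> \<le> K * t n" using K1 t[of n] by (intro mult_right_mono) auto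
    finally show ?thesis .
  qed
  with K1 show thesis by (intro that[of K]) (auto simp: F_def t_def)
qed

section \<open>Orthonormal polynomials and the expansion of monomials in them\<close>

context moment_functional
begin

lemma functional_add: "\<M> (x + y) = \<M> x + \<M> y"
  and functional_smult: "\<M> (smult c x) = c * \<M> x"
  using linear by (auto simp: Vector_Spaces.linear_iff)

lemma functional_0: "\<M> 0 = 0"
  using functional_smult[of 0 0] by simp

lemma functional_sum: "\<M> (sum g A) = (\<Sum>x\<in>A. \<M> (g x))"
  by (induction A rule: infinite_finite_induct) (auto simp: functional_0 functional_add)

lemma degree_P: "degree (P n) \<le> n"
proof (induction n rule: less_induct)
  case (less n)
  show ?case
  proof (cases n)
    case (Suc k)
    have "degree ([:0, 1:] * P k) \<le> Suc k"
      using degree_mult_le[of "[:0,1:]" "P k"] less[of k] Suc by simp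
    moreover have "degree (P (k - 1)) \<le> Suc k"
      using less[of "k - 1"] Suc by (meson diff_le_self le_SucI less_Suc_eq_le order_trans)
    ultimately show ?thesis
      unfolding Suc P_Suc
      by (auto intro!: degree_diff_le order_trans[OF degree_smult_le] simp del: mult_pCons_left)
  qed (simp add: P_0)
qed

lemma coeff_P_Suc:
  "coeff (P (Suc n)) l = (if l = 0 then 0 else coeff (P n) (l - 1)) / \<gamma> n
     - (if n = 0 then 0 else \<gamma> (n - 1) / \<gamma> n * coeff (P (n - 1)) l)"
  by (cases l) (auto simp: P_Suc)

text \<open>The recurrence either multiplies by the variable or goes back two indices, so
  \<open>P n\<close> contains only powers of the parity of \<open>n\<close>. In this form a sign
  outside a sum over coefficients can be exchanged for one depending on the summation index.\<close>

lemma P_parity: "(-1) ^ n * coeff (P n) l = (-1) ^ l * coeff (P n) l"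
proof (induction n arbitrary: l rule: less_induct)
  case (less n)
  show ?case
  proof (cases n)
    case 0
    then show ?thesis by (cases l) (auto simp: P_0)
  next
    case (Suc k)
    have a: "(-1) ^ Suc k * (if l = 0 then 0 else coeff (P k) (l - 1))
        = (-1) ^ l * (if l = 0 then 0 else coeff (P k) (l - 1))"
      using less[of k "l - 1"] Suc by (cases l) auto
    have b: "(-1) ^ Suc k * (if k = 0 then 0 else coeff (P (k - 1)) l)
        = (-1) ^ l * (if k = 0 then 0 else coeff (P (k - 1)) l)"
      using less[of "k - 1" l] Suc by (cases k) auto
    \<comment> \<open>For \<open>k = 0\<close> the truncated \<open>k - 1\<close> gives a spurious
      factor, which is multiplied by 0; the conditional now has the shape treated in
      \<open>b\<close>.\<close>
    have e: "coeff (P n) l = (if l = 0 then 0 else coeff (P k) (l - 1)) / \<gamma> k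
     - \<gamma> (k - 1) / \<gamma> k * (if k = 0 then 0 else coeff (P (k - 1)) l)"
      unfolding Suc coeff_P_Suc by simp
    show ?thesis
      unfolding e right_diff_distrib times_divide_eq_right mult.left_commute[of _ "\<gamma> (k - 1) / \<gamma> k"]
      unfolding Suc a b ..
  qed
qed

text \<open>The recurrence solved for its middle term: in the basis \<open>P\<close>, multiplication
  by the variable is a symmetric Jacobi matrix with zero diagonal.\<close>

lemma X_mult_P:
  "[:0, 1:] * P k = smult (\<gamma> k) (P (Suc k)) + (if k = 0 then 0 else smult (\<gamma> (k - 1)) (P (k - 1)))"
  using gamma_pos[of k] by (auto simp: P_Suc smult_diff_right)

text \<open>Equivalently, the entry \<open>(k, 0)\<close> of the \<open>j\<close>-th power of the
  Jacobi matrix.\<close>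

definition fourier_coeff :: "nat \<Rightarrow> nat \<Rightarrow> real" where
  "fourier_coeff j k = \<M> (P k * monom 1 j)"

lemma fourier_coeff_0: "fourier_coeff 0 k = (if k = 0 then 1 else 0)"
  using orthonormal[of 0 k] by (simp add: fourier_coeff_def P_0)

lemma fourier_coeff_Suc:
  "fourier_coeff (Suc j) k = \<gamma> k * fourier_coeff j (Suc k)
     + (if k = 0 then 0 else \<gamma> (k - 1) * fourier_coeff j (k - 1))"
proof -
  have "P k * monom 1 (Suc j) = ([:0, 1:] * P k) * monom 1 j"
    by (simp add: monom_Suc)
  also have "\<dots> = smult (\<gamma> k) (P (Suc k) * monom 1 j)
      + (if k = 0 then 0 else smult (\<gamma> (k - 1)) (P (k - 1) * monom 1 j))"
    unfolding X_mult_P by (simp add: algebra_simps)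
  finally show ?thesis
    by (auto simp: fourier_coeff_def functional_0 functional_add functional_smult)
qed

text \<open>Each step of the recursion moves the second index by at most one, starting from 0. This
  triangularity makes the Taylor coefficients of the chromatic expansion finite sums.\<close>

lemma fourier_coeff_eq_0: "k > j \<Longrightarrow> fourier_coeff j k = 0"
  by (induction j arbitrary: k) (auto simp: fourier_coeff_0 fourier_coeff_Suc)

text \<open>Multiplying the expansion by the variable and collecting the terms at each
  \<open>P k\<close> reproduces the recursion \<open>fourier_coeff_Suc\<close>.\<close>

lemma fourier_expansion_monom: "(\<Sum>k\<le>j. smult (fourier_coeff j k) (P k)) = monom 1 j"
proof (induction j)
  case 0
  show ?case by (simp add: fourier_coeff_0 P_0)
next
  case (Suc j)
  have "monom 1 (Suc j) = [:0, 1:] * (\<Sum>k\<le>j. smult (fourier_coeff j k) (P k))"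
    by (simp add: Suc monom_Suc)
  also have "\<dots> = (\<Sum>k\<le>j. smult (fourier_coeff j k) ([:0, 1:] * P k))"
    by (simp add: sum_distrib_left)
  also have "\<dots> = (\<Sum>k\<le>j. smult (fourier_coeff j k * \<gamma> k) (P (Suc k)))
      + (\<Sum>k\<le>j. if k = 0 then 0 else smult (fourier_coeff j k * \<gamma> (k - 1)) (P (k - 1)))"
    unfolding X_mult_P sum.distrib[symmetric] by (intro sum.cong) (auto simp: smult_add_right)
  also have "(\<Sum>k\<le>j. if k = 0 then 0 else smult (fourier_coeff j k * \<gamma> (k - 1)) (P (k - 1)))
      = (\<Sum>k<j. smult (fourier_coeff j (Suc k) * \<gamma> k) (P k))"
    by (subst sum.atMost_shift) simp
  \<comment> \<open>The added indices \<open>j\<close> and \<open>Suc j\<close> contribute 0 by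
    triangularity.\<close>
  also have "\<dots> = (\<Sum>k\<le>Suc j. smult (fourier_coeff j (Suc k) * \<gamma> k) (P k))"
    by (rule sum.mono_neutral_left) (auto simp: fourier_coeff_eq_0)
  also have "(\<Sum>k\<le>j. smult (fourier_coeff j k * \<gamma> k) (P (Suc k)))
      = (\<Sum>k\<le>Suc j. if k = 0 then 0 else smult (fourier_coeff j (k - 1) * \<gamma> (k - 1)) (P k))"
    by (subst sum.atMost_Suc_shift) simp
  finally have "monom 1 (Suc j) = \<dots> + (\<Sum>k\<le>Suc j. smult (fourier_coeff j (Suc k) * \<gamma> k) (P k))" .
  also have "\<dots> = (\<Sum>k\<le>Suc j. smult (fourier_coeff (Suc j) k) (P k))"
    unfolding sum.distrib[symmetric]
    by (intro sum.cong) (auto simp: fourier_coeff_Suc smult_add_left mult.commute)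
  finally show ?case by simp
qed

lemma fourier_coeff_moments:
  "fourier_coeff j k = (\<Sum>l\<le>degree (P k). coeff (P k) l * \<M> (monom 1 (l + j)))"
proof -
  have "P k * monom 1 j = (\<Sum>l\<le>degree (P k). monom (coeff (P k) l) l) * monom 1 j"
    using poly_as_sum_of_monoms[of "P k"] by simp
  also have "\<dots> = (\<Sum>l\<le>degree (P k). smult (coeff (P k) l) (monom 1 (l + j)))"
    by (simp add: sum_distrib_right mult_monom smult_monom)
  finally show ?thesis
    by (simp add: fourier_coeff_def functional_sum functional_smult)
qed

section \<open>Taylor coefficients of chromatic derivatives and formal reconstruction\<close>

lemma inverse_i_power: "inverse \<i> ^ k * (-1) ^ k = \<i> ^ k"
  by (simp flip: power_mult_distrib)

text \<open>An \<open>l\<close>-fold derivative shifts the moments by \<open>l\<close>, so summation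
  against the coefficients of \<open>P k\<close> rebuilds \<open>fourier_coeff j k\<close>. Parity
  turns \<open>\<i> ^ l * \<i> ^ l\<close> into the common sign \<open>(-1) ^ k\<close>. The
  function \<open>m\<close> is arbitrary here, since convergence of the moment series requires
  growth bounds on \<open>\<gamma>\<close>.\<close>

lemma chromatic_derivative_sums:
  assumes "\<And>w. (\<lambda>n. \<i> ^ n * of_real (\<M> (monom 1 n)) * w ^ n / fact n) sums m w"
  shows "(\<lambda>j. \<i> ^ (j + k) * of_real (fourier_coeff j k) * w ^ j / fact j)
           sums chromatic_derivative P k m w"
proof -
  define c where "c n = \<i> ^ n * of_real (\<M> (monom 1 n))" for n
  have "(\<lambda>j. inverse \<i> ^ k * (\<Sum>l\<le>degree (P k). of_real (coeff (P k) l) * \<i> ^ l *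
      (c (j + l) * w ^ j / fact j))) sums chromatic_derivative P k m w"
    unfolding chromatic_derivative_def
    by (intro sums_mult sums_sum sums_higher_deriv_exponential_series) (use assms in \<open>simp add: c_def\<close>)
  moreover have "inverse \<i> ^ k * (\<Sum>l\<le>degree (P k). of_real (coeff (P k) l) * \<i> ^ l *
      (c (j + l) * w ^ j / fact j)) = \<i> ^ (j + k) * of_real (fourier_coeff j k) * w ^ j / fact j" for j
  proof -
    have summand: "of_real (coeff (P k) l) * \<i> ^ l * (c (j + l) * w ^ j / fact j)
        = (-1) ^ k * \<i> ^ j * (w ^ j / fact j) * of_real (coeff (P k) l * \<M> (monom 1 (l + j)))" for l
    proof -
      have "\<i> ^ l * \<i> ^ l = (-1) ^ l" by (simp flip: power_mult_distrib)
      then have "of_real (coeff (P k) l) * \<i> ^ l * (c (j + l) * w ^ j / fact j)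
          = of_real ((-1) ^ l * coeff (P k) l) * \<i> ^ j * of_real (\<M> (monom 1 (l + j))) * (w ^ j / fact j)"
        by (simp add: c_def power_add add.commute mult_ac)
      also have "\<dots> = of_real ((-1) ^ k * coeff (P k) l) * \<i> ^ j * of_real (\<M> (monom 1 (l + j))) * (w ^ j / fact j)"
        by (simp only: P_parity[of k l])
      finally show ?thesis by (simp add: mult_ac)
    qed
    have "inverse \<i> ^ k * (\<Sum>l\<le>degree (P k). of_real (coeff (P k) l) * \<i> ^ l *
      (c (j + l) * w ^ j / fact j))
      = (inverse \<i> ^ k * (-1) ^ k) * \<i> ^ j * (w ^ j / fact j) * of_real (fourier_coeff j k)"
      unfolding summand by (simp add: fourier_coeff_moments sum_distrib_left sum_divide_distrib mult_ac)
    then show ?thesis unfolding inverse_i_power by (simp add: power_add mult_ac)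
  qed
  ultimately show ?thesis by simp
qed

text \<open>The powers of \<open>\<i>\<close> cancel and parity moves the sign inside, so that the
  right-hand side is \<open>P k\<close> evaluated at \<open>-\<i>\<close> times
  differentiation.\<close>

lemma chromatic_derivative_eq_sum:
  "(-1) ^ k * chromatic_derivative P k f u * \<i> ^ k
     = (\<Sum>l\<le>k. of_real (coeff (P k) l) * (-\<i>) ^ l * (deriv ^^ l) f u)"
proof -
  have trunc: "(\<Sum>l\<le>degree (P k). of_real (coeff (P k) l) * \<i> ^ l * (deriv ^^ l) f u)
      = (\<Sum>l\<le>k. of_real (coeff (P k) l) * \<i> ^ l * (deriv ^^ l) f u)"
    by (rule sum.mono_neutral_left) (use degree_P[of k] in \<open>auto simp: coeff_eq_0\<close>)
  have sign: "(-1) ^ k * (of_real (coeff (P k) l) * \<i> ^ l) = of_real (coeff (P k) l) * (-\<i>) ^ l" for l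
  proof -
    have "(-1) ^ k * (of_real (coeff (P k) l) * \<i> ^ l) = of_real ((-1) ^ k * coeff (P k) l) * \<i> ^ l"
      by simp
    also have "\<dots> = of_real (coeff (P k) l) * ((-1) ^ l * \<i> ^ l)"
      by (subst P_parity) simp
    finally show ?thesis by (simp flip: power_mult_distrib)
  qed
  have "inverse \<i> ^ k * \<i> ^ k = 1"
    by (simp flip: power_mult_distrib)
  then have "(-1) ^ k * (inverse \<i> ^ k * x) * \<i> ^ k = (-1) ^ k * x" for x
    by (metis mult.assoc mult.commute mult.left_neutral)
  then have "(-1) ^ k * chromatic_derivative P k f u * \<i> ^ k
      = (-1) ^ k * (\<Sum>l\<le>k. of_real (coeff (P k) l) * \<i> ^ l * (deriv ^^ l) f u)"
    unfolding chromatic_derivative_def trunc .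
  then show ?thesis
    by (simp add: sum_distrib_left sign[symmetric] mult.assoc)
qed

text \<open>Up to the factor \<open>\<i> ^ j\<close>, this is the image of
  \<open>fourier_expansion_monom\<close> under the linear map sending the \<open>l\<close>-th power
  of the variable to \<open>F l\<close>.\<close>

lemma chromatic_reconstruction:
  "(\<Sum>k\<le>j. (-1) ^ k * chromatic_derivative P k f u * \<i> ^ (j + k) * of_real (fourier_coeff j k))
     = (deriv ^^ j) f u"
proof -
  define F where "F l = (-\<i>) ^ l * (deriv ^^ l) f u" for l
  have "(\<Sum>k\<le>j. (-1) ^ k * chromatic_derivative P k f u * \<i> ^ (j + k) * of_real (fourier_coeff j k))
      = \<i> ^ j * (\<Sum>k\<le>j. of_real (fourier_coeff j k) * (\<Sum>l\<le>k. of_real (coeff (P k) l) * F l))"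
    unfolding F_def mult.assoc[symmetric] chromatic_derivative_eq_sum[symmetric] sum_distrib_left power_add
    by (intro sum.cong) (simp_all add: mult_ac)
  also have "(\<Sum>k\<le>j. of_real (fourier_coeff j k) * (\<Sum>l\<le>k. of_real (coeff (P k) l) * F l))
      = (\<Sum>k\<le>j. of_real (fourier_coeff j k) * (\<Sum>l\<le>j. of_real (coeff (P k) l) * F l))"
  \<comment> \<open>A common range for \<open>l\<close>, harmless by \<open>degree_P\<close>,
    permits the exchange of sums.\<close>
  proof -
    have "(\<Sum>l\<le>k. of_real (coeff (P k) l) * F l) = (\<Sum>l\<le>j. of_real (coeff (P k) l) * F l)"
      if "k \<le> j" for k
      by (rule sum.mono_neutral_left) (use that degree_P[of k] in \<open>auto simp: coeff_eq_0\<close>)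
    then show ?thesis by simp
  qed
  also have "\<dots> = (\<Sum>l\<le>j. of_real (coeff (\<Sum>k\<le>j. smult (fourier_coeff j k) (P k)) l) * F l)"
    unfolding sum_distrib_left
    by (subst sum.swap) (simp add: coeff_sum sum_distrib_left sum_distrib_right mult_ac)
  also have "\<dots> = F j"
  proof -
    have "(\<Sum>l\<le>j. of_real (coeff (monom 1 j) l) * F l) = (\<Sum>l\<le>j. if l = j then F l else 0)"
      by (intro sum.cong) auto
    then show ?thesis by (simp add: fourier_expansion_monom)
  qed
  also have "\<i> ^ j * F j = (deriv ^^ j) f u"
    unfolding F_def by (simp flip: power_mult_distrib mult.assoc)
  finally show ?thesis .
qed

end

section \<open>Coefficient estimates from the growth of the recurrence\<close>

locale regular_moment_functional = moment_functional +
  fixes L p :: real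
  assumes p: "0 \<le> p" "p < 1"
    and L: "L \<ge> 1"
    and gamma_le: "\<And>n. \<gamma> n \<le> L * real (Suc n) powr p"
    and inverse_gamma_le: "\<And>n. 1 / \<gamma> n \<le> L"
    and gamma_ratio_le: "\<And>n. \<gamma> n / \<gamma> (Suc n) \<le> L\<^sup>2"
begin

text \<open>Both terms of the recurrence are at most \<open>(2 * L) ^ k * L\<close>: in the second,
  the ratio bound \<open>L\<^sup>2\<close> is paid for by going back two indices.\<close>

lemma coeff_P_bound: "\<bar>coeff (P n) l\<bar> \<le> (2 * L) ^ n"
proof (induction n arbitrary: l rule: less_induct)
  case (less n)
  show ?case
  proof (cases n)
    case 0
    then show ?thesis by (cases l) (auto simp: P_0)
  next
    case (Suc k)
    have g: "\<gamma> i > 0" for i by (rule gamma_pos)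
    have t1: "\<bar>(if l = 0 then 0 else coeff (P k) (l - 1)) / \<gamma> k\<bar> \<le> (2 * L) ^ k * L"
    proof -
      have "\<bar>(if l = 0 then 0 else coeff (P k) (l - 1)) / \<gamma> k\<bar>
          = \<bar>if l = 0 then 0 else coeff (P k) (l - 1)\<bar> * (1 / \<gamma> k)"
        using g[of k] by (simp add: abs_divide)
      also have "\<dots> \<le> (2 * L) ^ k * L"
        using less[of k "l - 1"] Suc L inverse_gamma_le g[of k] by (intro mult_mono) auto
      finally show ?thesis .
    qed
    have t2: "\<bar>if k = 0 then 0 else \<gamma> (k - 1) / \<gamma> k * coeff (P (k - 1)) l\<bar> \<le> (2 * L) ^ k * L"
    proof (cases k)
      case (Suc i)
      have "\<bar>\<gamma> i / \<gamma> k * coeff (P i) l\<bar> = \<gamma> i / \<gamma> k * \<bar>coeff (P i) l\<bar>"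
        using g[of i] g[of k] by (simp add: abs_mult)
      also have "\<dots> \<le> L\<^sup>2 * (2 * L) ^ i"
        using less[of i l] Suc \<open>n = Suc k\<close> L gamma_ratio_le[of i] by (intro mult_mono) auto
      also have "\<dots> \<le> (2 * L) ^ k * L"
        using L by (simp add: Suc power2_eq_square)
      finally show ?thesis using Suc by simp
    qed (use L in simp)
    have tri: "\<bar>x - y\<bar> \<le> c + c" if "\<bar>x\<bar> \<le> c" "\<bar>y\<bar> \<le> c" for x y c :: real
      using that by linarith
    show ?thesis
      unfolding Suc coeff_P_Suc by (rule order_trans[OF tri[OF t1 t2]]) (simp add: mult_ac)
  qed
qed

text \<open>Each of the two terms of the recursion costs at most
  \<open>L * real (Suc j) powr p\<close>, and these factors multiply up to the power of the
  factorial.\<close>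

lemma fourier_coeff_bound: "\<bar>fourier_coeff j k\<bar> \<le> (2 * L) ^ j * fact j powr p"
proof (induction j arbitrary: k)
  case 0
  show ?case by (simp add: fourier_coeff_0)
next
  case (Suc j)
  define b where "b = (2 * L) ^ j * fact j powr p"
  have b: "b \<ge> 0" using L by (simp add: b_def)
  \<comment> \<open>A large \<open>\<gamma> i\<close> does no harm: for \<open>i > j\<close> it only
    meets vanishing coefficients.\<close>
  have step: "\<bar>\<gamma> i * fourier_coeff j k\<bar> \<le> L * real (Suc j) powr p * b" if "i \<le> j \<or> k > j" for i k
  proof (cases "k > j")
    case True
    then show ?thesis using L b by (simp add: fourier_coeff_eq_0)
  next
    case False
    then have "real (Suc i) powr p \<le> real (Suc j) powr p"
      using that p by (intro powr_mono2) auto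
    then have "\<gamma> i \<le> L * real (Suc j) powr p"
      using gamma_le[of i] L mult_left_mono[of "real (Suc i) powr p" "real (Suc j) powr p" L] by linarith
    then have "\<gamma> i * \<bar>fourier_coeff j k\<bar> \<le> L * real (Suc j) powr p * b"
      using Suc[of k] L b by (intro mult_mono) (auto simp: b_def)
    then show ?thesis using gamma_pos[of i] by (simp add: abs_mult)
  qed
  have "\<bar>\<gamma> k * fourier_coeff j (Suc k)\<bar> \<le> L * real (Suc j) powr p * b"
    by (rule step) auto
  moreover have "\<bar>if k = 0 then 0 else \<gamma> (k - 1) * fourier_coeff j (k - 1)\<bar> \<le> L * real (Suc j) powr p * b"
    using step[of "k - 1" "k - 1"] le_less_linear[of "k - 1" j] L b by auto
  ultimately have "\<bar>fourier_coeff (Suc j) k\<bar> \<le> 2 * (L * real (Suc j) powr p * b)"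
    unfolding fourier_coeff_Suc by linarith
  also have "\<dots> = (2 * L) ^ Suc j * fact (Suc j) powr p"
    by (simp add: b_def powr_mult del: of_nat_Suc)
  finally show ?case .
qed

section \<open>Absolute moments and the Fourier transform\<close>

lemma moment_bound: "\<bar>\<M> (monom 1 n)\<bar> \<le> (2 * L) ^ n * fact n powr p"
  using fourier_coeff_bound[of n 0] by (simp add: fourier_coeff_def P_0)

text \<open>Odd absolute moments are not values of \<open>\<M>\<close>, so they are bounded by the
  total mass 1 and the moment of order \<open>2 * n\<close> through the inequality of arithmetic and
  geometric means. With the target \<open>t\<close> as weight, each half contributes at most
  \<open>t / 2\<close>.\<close>

lemma absolute_moment_bound:
  assumes "moment_distribution \<M> a"
  shows "(LINT \<omega>|stieltjes_measure a. \<bar>\<omega>\<bar> ^ n) \<le> (4 * L) ^ n * fact n powr p"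
proof -
  have mom: "has_bochner_integral (stieltjes_measure a) (\<lambda>\<omega>. \<omega> ^ n) (\<M> (monom 1 n))" for n
    using assms by (simp add: moment_distribution_def)
  define t where "t = (4 * L) ^ n * fact n powr p"
  have t: "t > 0" using L by (simp add: t_def)
  have half: "\<bar>\<omega>\<bar> ^ n \<le> t / 2 * \<omega> ^ 0 + 1 / (2 * t) * \<omega> ^ (2 * n)" for \<omega> :: real
  proof -
    have "0 \<le> (t - \<bar>\<omega>\<bar> ^ n)\<^sup>2" by simp
    moreover have "\<omega> ^ (2 * n) = (\<bar>\<omega>\<bar> ^ n)\<^sup>2"
      by (metis mult.commute power_even_abs power_mult even_mult_iff even_numeral power_abs)
    ultimately show ?thesis using t by (simp add: field_simps power2_eq_square)
  qed
  have int: "has_bochner_integral (stieltjes_measure a)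
      (\<lambda>\<omega>. t / 2 * \<omega> ^ 0 + 1 / (2 * t) * \<omega> ^ (2 * n))
      (t / 2 * \<M> (monom 1 0) + 1 / (2 * t) * \<M> (monom 1 (2 * n)))"
    by (intro has_bochner_integral_add has_bochner_integral_mult_right mom)
  have "(LINT \<omega>|stieltjes_measure a. \<bar>\<omega>\<bar> ^ n)
      \<le> (LINT \<omega>|stieltjes_measure a. t / 2 * \<omega> ^ 0 + 1 / (2 * t) * \<omega> ^ (2 * n))"
  proof (rule integral_mono)
    show "integrable (stieltjes_measure a) (\<lambda>\<omega>. \<bar>\<omega>\<bar> ^ n)"
      using mom[of n] by (simp add: has_bochner_integral_iff flip: power_abs)
    show "integrable (stieltjes_measure a) (\<lambda>\<omega>. t / 2 * \<omega> ^ 0 + 1 / (2 * t) * \<omega> ^ (2 * n))"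
      using int by (simp add: has_bochner_integral_iff)
  qed (rule half)
  also have "\<dots> = t / 2 + \<M> (monom 1 (2 * n)) / (2 * t)"
    using int normalized by (simp add: has_bochner_integral_iff one_pCons monom_0)
  also have "\<M> (monom 1 (2 * n)) \<le> t\<^sup>2"
  proof -
    \<comment> \<open>The central binomial coefficient is at most \<open>4 ^ n\<close>; this extra
      factor is why \<open>4 * L\<close> replaces \<open>2 * L\<close>.\<close>
    have "real (fact (2 * n)) \<le> real (4 ^ n * (fact n)\<^sup>2)"
    proof -
      have "(2 * n choose n) \<le> 4 ^ n"
        using binomial_le_pow2[of "2 * n" n] by (simp add: power_mult)
      moreover have "fact n * fact n * (2 * n choose n) = fact (2 * n)"
        using binomial_fact_lemma[of n "2 * n"] by simp
      ultimately show ?thesis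
        by (metis mult.commute mult_le_mono2 of_nat_le_iff power2_eq_square)
    qed
    then have "fact (2 * n) powr p \<le> (4 ^ n * (fact n)\<^sup>2) powr p"
      using p by (intro powr_mono2) auto
    also have "\<dots> = (4 ^ n) powr p * (fact n powr p)\<^sup>2"
      by (simp add: powr_mult power2_eq_square)
    also have "\<dots> \<le> 4 ^ n * (fact n powr p)\<^sup>2"
    proof (intro mult_right_mono)
      show "(4 ^ n) powr p \<le> (4 ^ n :: real)"
        using powr_mono[of p 1 "4 ^ n"] p by simp
    qed simp
    finally have "(2 * L) ^ (2 * n) * fact (2 * n) powr p \<le> (2 * L) ^ (2 * n) * (4 ^ n * (fact n powr p)\<^sup>2)"
      using L by (intro mult_left_mono) auto
    also have "\<dots> = t\<^sup>2"
    proof -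
      have "4 = 2 * (2 :: real)" "4 * L = 2 * (2 * L)" by simp_all
      then have "4 ^ n = 2 ^ n * (2 ^ n :: real)" "(4 * L) ^ n = 2 ^ n * (2 * L) ^ n"
        by (metis power_mult_distrib)+
      moreover have "(2 * L) ^ (2 * n) = (2 * L) ^ n * (2 * L) ^ n"
        by (simp only: mult_2 power_add)
      ultimately show ?thesis
        unfolding t_def power2_eq_square by (simp only: mult_ac)
    qed
    finally show ?thesis using moment_bound[of "2 * n"] by linarith
  qed
  then have "t / 2 + \<M> (monom 1 (2 * n)) / (2 * t) \<le> t"
    using t by (simp add: field_simps power2_eq_square)
  finally show ?thesis by (simp add: t_def)
qed

text \<open>The exponential series is integrated term by term. The absolute moments use up only the
  power \<open>p\<close> of the factorial, and the remaining power \<open>1 - p > 0\<close> ensures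
  absolute summability for every \<open>w\<close>.\<close>

lemma fourier_transform_sums:
  assumes "moment_distribution \<M> a"
  shows "(\<lambda>n. \<i> ^ n * of_real (\<M> (monom 1 n)) * w ^ n / fact n) sums fourier_transform a w"
proof -
  let ?\<mu> = "stieltjes_measure a"
  have mom: "has_bochner_integral ?\<mu> (\<lambda>\<omega>. \<omega> ^ n) (\<M> (monom 1 n))" for n
    using assms by (simp add: moment_distribution_def)
  define g where "g n \<omega> = (\<i> * w) ^ n / fact n * of_real (\<omega> ^ n)" for n and \<omega> :: real
  have int: "has_bochner_integral ?\<mu> (g n) ((\<i> * w) ^ n / fact n * of_real (\<M> (monom 1 n)))" for n
    unfolding g_def using mom[of n]
    by (intro has_bochner_integral_mult_right has_bochner_integral_of_real)
  have exp: "(\<lambda>n. g n \<omega>) sums exp (\<i> * of_real \<omega> * w)" for \<omega>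
    using exp_converges[of "\<i> * of_real \<omega> * w"]
    by (simp add: g_def power_mult_distrib scaleR_conv_of_real field_simps)
  have norm_g: "norm (g n \<omega>) = cmod w ^ n / fact n * \<bar>\<omega>\<bar> ^ n" for n \<omega>
    by (simp add: g_def norm_mult norm_divide norm_power)
  have "(\<lambda>n. integral\<^sup>L ?\<mu> (g n)) sums (LINT \<omega>|?\<mu>. (\<Sum>n. g n \<omega>))"
  proof (rule sums_integral)
    show "integrable ?\<mu> (g n)" for n
      using int by (simp add: has_bochner_integral_iff)
    have "summable (\<lambda>n. norm (g n \<omega>))" for \<omega>
      using summable_exp[of "cmod w * \<bar>\<omega>\<bar>"]
      by (simp add: norm_g power_mult_distrib field_simps)
    then show "AE \<omega> in ?\<mu>. summable (\<lambda>n. norm (g n \<omega>))" by simp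
    show "summable (\<lambda>n. LINT \<omega>|?\<mu>. norm (g n \<omega>))"
    proof (rule summable_comparison_test)
      show "summable (\<lambda>n. (4 * L * cmod w) ^ n * fact n powr (- (1 - p)))"
        using L p by (intro summable_power_over_fact_powr) auto
      show "\<exists>N. \<forall>n\<ge>N. norm (LINT \<omega>|?\<mu>. norm (g n \<omega>))
          \<le> (4 * L * cmod w) ^ n * fact n powr (- (1 - p))"
      proof (intro exI allI impI)
        fix n
        have "norm (LINT \<omega>|?\<mu>. norm (g n \<omega>)) = cmod w ^ n / fact n * (LINT \<omega>|?\<mu>. \<bar>\<omega>\<bar> ^ n)"
          unfolding norm_g by (simp add: Bochner_Integration.integral_nonneg abs_mult)
        also have "\<dots> \<le> cmod w ^ n / fact n * ((4 * L) ^ n * fact n powr p)"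
          by (intro mult_left_mono absolute_moment_bound assms) auto
        also have "\<dots> = (4 * L * cmod w) ^ n * fact n powr (- (1 - p))"
          by (simp add: power_mult_distrib powr_diff field_simps)
        finally show "norm (LINT \<omega>|?\<mu>. norm (g n \<omega>))
          \<le> (4 * L * cmod w) ^ n * fact n powr (- (1 - p))" .
      qed
    qed
  qed
  moreover have "(\<Sum>n. g n \<omega>) = exp (\<i> * of_real \<omega> * w)" for \<omega>
    using exp by (simp add: sums_iff)
  moreover have "integral\<^sup>L ?\<mu> (g n) = \<i> ^ n * of_real (\<M> (monom 1 n)) * w ^ n / fact n" for n
    using int[of n] by (simp add: has_bochner_integral_iff power_mult_distrib mult_ac)
  ultimately show ?thesis by (simp add: fourier_transform_def)
qed

section \<open>Convergence of the chromatic expansion\<close>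

text \<open>
  Expanded around \<open>u\<close>, the error of the \<open>N\<close>-th partial sum has no terms of degree below \<open>N\<close>,
  and its remaining coefficients are dominated, uniformly in \<open>N\<close>, by a geometric series.
\<close>
lemma chromatic_expansion_uniform_limit:
  assumes dist: "moment_distribution \<M> a"
    and B: "B > 0" and K: "K > 0" and \<rho>: "\<rho> \<ge> 0"
    and bound: "\<And>n. cmod ((deriv ^^ n) f u) \<le> K * (B ^ n * fact n powr (1 - p))"
    and small: "16 * L\<^sup>2 * B * \<rho> < 1"
    and S: "S \<subseteq> cball u \<rho>"
    and taylor: "\<And>z. z \<in> S \<Longrightarrow> (\<lambda>n. (deriv ^^ n) f u * (z - u) ^ n / fact n) sums f z"
  shows "uniform_limit S (\<lambda>N z. \<Sum>k<N. chromatic_term P a f u k z) f sequentially"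
proof -
  define q where "q = 1 - p"
  have q: "q > 0" using p by (simp add: q_def)
  define s where "s n = B ^ n * fact n powr q" for n
  obtain c where c: "c > 0" and dom: "\<And>j k. j \<le> k \<Longrightarrow> s j \<le> c * s k"
    using power_fact_powr_dominates_past[OF B q] unfolding s_def by blast
  have s0: "s n \<ge> 0" for n using B by (simp add: s_def)
  \<comment> \<open>\<open>e k j\<close> is the contribution of the \<open>k\<close>-th chromatic
    term to the \<open>j\<close>-th Taylor derivative at \<open>u\<close>.\<close>
  define D where "D k = (-1) ^ k * chromatic_derivative P k f u * \<i> ^ k" for k
  define e where "e k j = D k * \<i> ^ j * of_real (fourier_coeff j k)" for k j
  have e_sum: "(\<Sum>k\<le>j. e k j) = (deriv ^^ j) f u" for j
    using chromatic_reconstruction[of f u j] by (simp add: e_def D_def power_add mult_ac)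
  have e_zero: "e k j = 0" if "k > j" for k j
    using that by (simp add: e_def fourier_coeff_eq_0)
  have D_bound: "cmod (D k) \<le> real (Suc k) * ((2 * L) ^ k * (K * (c * s k)))" for k
  proof -
    have "cmod (D k) \<le> (\<Sum>l\<le>k. (2 * L) ^ k * (K * (c * s k)))"
      unfolding D_def chromatic_derivative_eq_sum
    proof (rule sum_norm_le)
      fix l assume "l \<in> {..k}"
      then have "K * s l \<le> K * (c * s k)" using dom K by simp
      then have "cmod ((deriv ^^ l) f u) \<le> K * (c * s k)"
        using bound[of l] by (simp add: s_def q_def)
      then have "\<bar>coeff (P k) l\<bar> * cmod ((deriv ^^ l) f u) \<le> (2 * L) ^ k * (K * (c * s k))"
        using L by (intro mult_mono coeff_P_bound) auto
      then show "cmod (of_real (coeff (P k) l) * (-\<i>) ^ l * (deriv ^^ l) f u) \<le> (2 * L) ^ k * (K * (c * s k))"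
        by (simp add: norm_mult norm_power)
    qed
    then show ?thesis by simp
  qed
  \<comment> \<open>Two coefficient bounds give \<open>(2 * L)\<^sup>2\<close>. The remaining 4 pays
    for two factors \<open>Suc j\<close>, each at most \<open>2 ^ j\<close>: one from the sum
    defining \<open>D k\<close>, one from the sum over \<open>k\<close>.\<close>
  define x where "x = 16 * L\<^sup>2 * B * \<rho>"
  have x: "0 \<le> x" "x < 1" using small B \<rho> by (auto simp: x_def)
  \<comment> \<open>One \<open>c\<close> comes from passing to the top derivative in
    \<open>D_bound\<close>, the other from replacing \<open>s k\<close> by
    \<open>s j\<close>.\<close>
  define C where "C = K * c\<^sup>2"
  have C: "C \<ge> 0" using K by (simp add: C_def)
  have e_bound: "cmod (e k j) \<le> real (Suc j) * (C * (4 * L\<^sup>2 * B) ^ j * fact j)" if "k \<le> j" for k j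
  proof -
    have "cmod (e k j) = cmod (D k) * \<bar>fourier_coeff j k\<bar>"
      by (simp add: e_def norm_mult norm_power)
    also have "\<dots> \<le> (real (Suc j) * ((2 * L) ^ j * (K * (c * (c * s j))))) * ((2 * L) ^ j * fact j powr p)"
    proof (intro mult_mono fourier_coeff_bound)
      have "real (Suc k) * ((2 * L) ^ k * (K * (c * s k)))
          \<le> real (Suc j) * ((2 * L) ^ j * (K * (c * (c * s j))))"
        using that L K c s0 dom by (intro mult_mono power_increasing) auto
      then show "cmod (D k) \<le> real (Suc j) * ((2 * L) ^ j * (K * (c * (c * s j))))"
        using D_bound[of k] by linarith
    qed (use L K c s0 in auto)
    also have "\<dots> = real (Suc j) * (C * (4 * L\<^sup>2 * B) ^ j * (fact j powr q * fact j powr p))"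
    proof -
      have "4 * L\<^sup>2 * B = (2 * L) * (2 * L) * B" by (simp add: power2_eq_square)
      then have "(4 * L\<^sup>2 * B) ^ j = (2 * L) ^ j * (2 * L) ^ j * B ^ j"
        by (simp only: power_mult_distrib)
      then show ?thesis by (simp add: C_def s_def power2_eq_square mult_ac)
    qed
    \<comment> \<open>The exponents are complementary, leaving exactly the factorial that the Taylor
      denominator cancels.\<close>
    also have "fact j powr q * fact j powr p = (fact j :: real)"
      by (simp add: q_def flip: powr_add)
    finally show ?thesis .
  qed
  define d where "d N j = (deriv ^^ j) f u - (\<Sum>k<N. e k j)" for N j
  \<comment> \<open>By reconstruction the error coefficient is a tail of a finite sum, empty for
    \<open>j < N\<close>; the upper limit \<open>max N (Suc j)\<close> treats both cases at
    once.\<close>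
  have d_eq: "d N j = (\<Sum>k\<in>{N..j}. e k j)" for N j
  proof -
    have "(\<Sum>k\<le>j. e k j) = (\<Sum>k<max N (Suc j). e k j)"
      by (rule sum.mono_neutral_left) (auto simp: e_zero)
    also have "\<dots> = (\<Sum>k<N. e k j) + (\<Sum>k=N..<max N (Suc j). e k j)"
      by (simp add: lessThan_atLeast0 sum.atLeastLessThan_concat)
    also have "(\<Sum>k=N..<max N (Suc j). e k j) = (\<Sum>k\<in>{N..j}. e k j)"
      by (intro sum.cong) auto
    finally show ?thesis by (simp add: d_def e_sum)
  qed
  have d_zero: "d N j = 0" if "j < N" for N j
    using that by (simp add: d_eq)
  have d_bound: "cmod (d N j) * \<rho> ^ j / fact j \<le> C * x ^ j" for N j
  proof -
    have pow2: "real (Suc j) \<le> 2 ^ j"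
      using Suc_leI[OF less_exp[of j]] by (metis of_nat_le_iff of_nat_numeral of_nat_power)
    define y where "y = C * (4 * L\<^sup>2 * B) ^ j * fact j"
    have y: "y \<ge> 0" using C B by (simp add: y_def)
    have "cmod (d N j) \<le> (\<Sum>k\<in>{N..j}. real (Suc j) * y)"
      unfolding d_eq y_def by (intro sum_norm_le e_bound) auto
    also have "\<dots> \<le> real (Suc j) * (real (Suc j) * y)"
      using y by (simp add: mult_right_mono)
    also have "\<dots> \<le> 2 ^ j * (2 ^ j * y)"
      using y pow2 by (intro mult_mono) auto
    also have "\<dots> = C * (16 * L\<^sup>2 * B) ^ j * fact j"
    proof -
      have "16 * L\<^sup>2 * B = 2 * 2 * (4 * L\<^sup>2 * B)" by simp
      then have "(16 * L\<^sup>2 * B) ^ j = 2 ^ j * 2 ^ j * (4 * L\<^sup>2 * B) ^ j"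
        by (simp only: power_mult_distrib)
      then show ?thesis by (simp add: y_def mult_ac)
    qed
    finally have "cmod (d N j) * \<rho> ^ j / fact j \<le> C * (16 * L\<^sup>2 * B) ^ j * fact j * \<rho> ^ j / fact j"
      using \<rho> by (intro divide_right_mono mult_right_mono) auto
    then show ?thesis by (simp add: x_def power_mult_distrib)
  qed
  have err: "cmod ((\<Sum>k<N. chromatic_term P a f u k z) - f z) \<le> C * x ^ N / (1 - x)"
    if z: "z \<in> S" for N z
  proof -
    define w where "w = z - u"
    have w: "cmod w \<le> \<rho>" using z S by (auto simp: w_def dist_norm norm_minus_commute)
    have "(\<lambda>j. e k j * w ^ j / fact j) sums chromatic_term P a f u k z" for k
    proof -
      have "(\<lambda>j. \<i> ^ (j + k) * of_real (fourier_coeff j k) * w ^ j / fact j)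
          sums chromatic_derivative P k (fourier_transform a) w"
        by (intro chromatic_derivative_sums fourier_transform_sums dist)
      from sums_mult[OF this, of "(-1) ^ k * chromatic_derivative P k f u"]
      show ?thesis
        by (simp add: chromatic_term_def w_def e_def D_def power_add mult_ac)
    qed
    then have "(\<lambda>j. (deriv ^^ j) f u * w ^ j / fact j - (\<Sum>k<N. e k j * w ^ j / fact j))
        sums (f z - (\<Sum>k<N. chromatic_term P a f u k z))"
      using taylor[OF z] by (intro sums_diff sums_sum) (auto simp: w_def)
    then have "(\<lambda>j. d N j * w ^ j / fact j) sums (f z - (\<Sum>k<N. chromatic_term P a f u k z))"
      by (simp add: d_def left_diff_distrib diff_divide_distrib sum_distrib_right sum_divide_distrib)
    moreover have "(\<Sum>j<N. d N j * w ^ j / fact j) = 0"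
      by (simp add: d_zero)
    \<comment> \<open>Dropping the \<open>N\<close> vanishing terms yields the factor
      \<open>x ^ N\<close>, which makes the error bound uniform on \<open>S\<close>.\<close>
    ultimately have "(\<lambda>j. d N (j + N) * w ^ (j + N) / fact (j + N))
        sums (f z - (\<Sum>k<N. chromatic_term P a f u k z))"
      using sums_iff_shift[of "\<lambda>j. d N j * w ^ j / fact j" N] by simp
    moreover have "(\<lambda>j. C * x ^ N * x ^ j) sums (C * x ^ N * (1 / (1 - x)))"
      using x by (intro sums_mult geometric_sums) auto
    moreover have "cmod (d N (j + N) * w ^ (j + N) / fact (j + N)) \<le> C * x ^ N * x ^ j" for j
    proof -
      have "cmod (d N (j + N) * w ^ (j + N) / fact (j + N))
          = cmod (d N (j + N)) * cmod w ^ (j + N) / fact (j + N)"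
        by (simp add: norm_mult norm_divide norm_power)
      also have "\<dots> \<le> cmod (d N (j + N)) * \<rho> ^ (j + N) / fact (j + N)"
        using w by (intro divide_right_mono mult_left_mono power_mono) auto
      also have "\<dots> \<le> C * x ^ N * x ^ j"
        using d_bound[of N "j + N"] by (simp add: power_add mult_ac)
      finally show ?thesis .
    qed
    ultimately have "cmod (f z - (\<Sum>k<N. chromatic_term P a f u k z)) \<le> C * x ^ N * (1 / (1 - x))"
      by (rule norm_sums_le)
    then show ?thesis by (simp add: norm_minus_commute)
  qed
  have lim: "(\<lambda>N. C * x ^ N / (1 - x)) \<longlonglongrightarrow> 0"
    using x by (intro tendsto_eq_intros LIMSEQ_realpow_zero) auto
  show ?thesis
  proof (rule uniform_limitI)
    fix \<epsilon> :: real assume "\<epsilon> > 0"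
    with lim have "\<forall>\<^sub>F N in sequentially. C * x ^ N / (1 - x) < \<epsilon>"
      by (rule order_tendstoD)
    then show "\<forall>\<^sub>F N in sequentially. \<forall>z\<in>S. dist (\<Sum>k<N. chromatic_term P a f u k z) (f z) < \<epsilon>"
    proof eventually_elim
      case (elim N)
      then show ?case using err[of _ N] by (auto simp: dist_norm intro: le_less_trans)
    qed
  qed
qed

end

section \<open>Normalization of the constants, analytic continuation and the theorem\<close>

lemma weakly_bounded_imp_regular:
  assumes "moment_functional \<M> P \<gamma>" "weakly_bounded \<gamma> p"
  obtains L where "regular_moment_functional \<M> P \<gamma> L p"
proof -
  interpret moment_functional \<M> P \<gamma> by fact
  obtain M r where p: "0 \<le> p" "p < 1" and M: "M \<ge> 1"
    and lo: "\<And>n. 1 / M \<le> \<gamma> n" and up: "\<And>n. \<gamma> n \<le> M * real (n + r) powr p"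
    and ratio: "\<And>n. \<gamma> n / \<gamma> (Suc n) \<le> M\<^sup>2"
    using assms(2) unfolding weakly_bounded_def by metis
  \<comment> \<open>For \<open>r = 0\<close>, the value \<open>0 powr p = 0\<close> would contradict
    \<open>\<gamma> 0 > 0\<close>.\<close>
  have "r \<noteq> 0"
    using up[of 0] gamma_pos[of 0] by (intro notI) simp
  then have r: "real r \<ge> 1" by simp
  \<comment> \<open>The shift is absorbed by \<open>n + r \<le> Suc n * r\<close>, and then
    \<open>real r powr p \<le> real r\<close>.\<close>
  define L where "L = M * real r"
  have M_le: "M \<le> L" using M r by (simp add: L_def)
  have "regular_moment_functional \<M> P \<gamma> L p"
  proof unfold_locales
    show "L \<ge> 1" using M_le M by linarith
    show "\<gamma> n \<le> L * real (Suc n) powr p" for n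
    proof -
      have "real (n + r) powr p \<le> (real (Suc n) * real r) powr p"
      proof (rule powr_mono2)
        have "real n * 1 \<le> real n * real r" using r by (intro mult_left_mono) auto
        then show "real (n + r) \<le> real (Suc n) * real r" by (simp add: algebra_simps)
      qed (use p in auto)
      also have "\<dots> = real (Suc n) powr p * real r powr p"
        by (simp add: powr_mult)
      also have "\<dots> \<le> real (Suc n) powr p * real r"
        using powr_mono[of p 1 "real r"] p r by (intro mult_left_mono) auto
      finally have "M * real (n + r) powr p \<le> M * (real (Suc n) powr p * real r)"
        using M by (intro mult_left_mono) auto
      with up[of n] show ?thesis by (simp add: L_def mult_ac)
    qed
    show "1 / \<gamma> n \<le> L" for n
    proof -
      have "1 / \<gamma> n \<le> M" using lo[of n] gamma_pos[of n] M by (simp add: field_simps)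
      with M_le show ?thesis by linarith
    qed
    show "\<gamma> n / \<gamma> (Suc n) \<le> L\<^sup>2" for n
      using ratio[of n] power_mono[OF M_le, of 2] M by linarith
  qed (use p in auto)
  then show thesis by (rule that)
qed

text \<open>The Taylor series defines an entire function that agrees with \<open>f\<close> near
  \<open>u\<close>, hence on \<open>G\<close> by the identity theorem. This reaches points of
  \<open>G\<close> lying in no disc around \<open>u\<close> inside \<open>G\<close>.\<close>

lemma taylor_sums_on_connected:
  assumes "open G" "connected G" "f analytic_on G" "u \<in> G"
    and sm: "\<And>w. summable (\<lambda>n. (deriv ^^ n) f u * w ^ n / fact n)"
    and z: "z \<in> G"
  shows "(\<lambda>n. (deriv ^^ n) f u * (z - u) ^ n / fact n) sums f z"
proof -
  have hol: "f holomorphic_on G" using assms analytic_imp_holomorphic by blast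
  define h where "h w = (\<Sum>n. (deriv ^^ n) f u * w ^ n / fact n)" for w
  have h: "(\<lambda>n. (deriv ^^ n) f u * w ^ n / fact n) sums h w" for w
    using sm unfolding h_def by (rule summable_sums)
  have "h holomorphic_on UNIV"
    using sums_deriv_exponential_series(1)[OF h] by (subst holomorphic_on_open) auto
  then have "h \<circ> (\<lambda>z. z - u) holomorphic_on G"
    by (intro holomorphic_on_compose_gen[of _ G h UNIV]) (auto intro!: holomorphic_intros)
  then have "(\<lambda>z. h (z - u)) holomorphic_on G"
    by (simp add: o_def)
  moreover obtain r where r: "r > 0" "ball u r \<subseteq> G"
    using assms by (meson open_contains_ball)
  have "h (z - u) = f z" if "z \<in> ball u r" for z
    using holomorphic_power_series[OF holomorphic_on_subset[OF hol r(2)] that] h[of "z - u"]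
    by (auto intro: sums_unique2 simp: field_simps)
  ultimately have "h (z - u) = f z"
    using analytic_continuation_open[of "ball u r" G "\<lambda>z. h (z - u)" f z] assms r z hol by auto
  then show ?thesis using h[of "z - u"] by simp
qed

theorem corollary6p10:
  fixes \<M> :: "real poly \<Rightarrow> real" and P :: "nat \<Rightarrow> real poly" and \<gamma> :: "nat \<Rightarrow> real"
    and a :: "real \<Rightarrow> real" and p :: real
    and f :: "complex \<Rightarrow> complex" and G :: "complex set" and u :: complex
  assumes "moment_functional \<M> P \<gamma>"
    and "weakly_bounded \<gamma> p"
    and "moment_distribution \<M> a"
    and "open G" and "connected G" and "f analytic_on G" and "u \<in> G"
  shows "(Bseq (root_sequence p f u) \<longrightarrow>
            (\<exists>\<rho>>0. ball u \<rho> \<subseteq> G \<and>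
               uniform_limit (ball u \<rho>) (\<lambda>N z. \<Sum>k<N. chromatic_term P a f u k z) f sequentially))
       \<and> (root_sequence p f u \<longlonglongrightarrow> 0 \<longrightarrow>
            (\<forall>z\<in>G. (\<lambda>k. chromatic_term P a f u k z) sums f z) \<and>
            (\<forall>\<rho>>0. cball u \<rho> \<subseteq> G \<longrightarrow>
               uniform_limit (cball u \<rho>) (\<lambda>N z. \<Sum>k<N. chromatic_term P a f u k z) f sequentially))"
proof (intro conjI impI ballI allI)
  obtain L where "regular_moment_functional \<M> P \<gamma> L p"
    using weakly_bounded_imp_regular assms(1,2) by blast
  then interpret regular_moment_functional \<M> P \<gamma> L p .
  let ?S = "\<lambda>N z. \<Sum>k<N. chromatic_term P a f u k z"
  {
    assume "Bseq (root_sequence p f u)"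
    then obtain B where B: "B > 0" "\<And>n. norm (root_sequence p f u n) \<le> B"
      by (auto simp: Bseq_def)
    then have "root_sequence p f u n \<le> B" for n
      using abs_le_D1 by fastforce
    then obtain K where K: "K > 0"
      "\<And>n. cmod ((deriv ^^ n) f u) \<le> K * (B ^ n * fact n powr (1 - p))"
      using root_sequence_bound[of p f u B] B(1) by auto
    obtain r where r: "r > 0" "ball u r \<subseteq> G"
      using assms by (meson open_contains_ball)
    \<comment> \<open>The first entry keeps the disc where the Taylor series represents
      \<open>f\<close>; the second keeps the geometric ratio at most one half.\<close>
    define \<rho> where "\<rho> = min r (1 / (32 * L\<^sup>2 * B))"
    have \<rho>: "\<rho> > 0" "ball u \<rho> \<subseteq> ball u r" and le: "\<rho> \<le> 1 / (32 * L\<^sup>2 * B)"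
      using r B L by (auto simp: \<rho>_def)
    have "f holomorphic_on ball u r"
      using assms r analytic_imp_holomorphic holomorphic_on_subset by blast
    then have taylor: "(\<lambda>n. (deriv ^^ n) f u * (z - u) ^ n / fact n) sums f z" if "z \<in> ball u \<rho>" for z
      using holomorphic_power_series[of f u r z] that \<rho> by (auto simp: field_simps)
    have "uniform_limit (ball u \<rho>) ?S f sequentially"
    proof (rule chromatic_expansion_uniform_limit[OF assms(3) B(1) K(1) _ K(2)])
      show "16 * L\<^sup>2 * B * \<rho> < 1" using le B L by (simp add: field_simps)
    qed (use \<rho> taylor in auto)
    then show "\<exists>\<rho>>0. ball u \<rho> \<subseteq> G \<and> uniform_limit (ball u \<rho>) ?S f sequentially"
      using \<rho> r by blast
  next
    assume lim: "root_sequence p f u \<longlonglongrightarrow> 0"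
    \<comment> \<open>Convergence to 0 allows any positive \<open>B\<close>, at the price of a
      \<open>K\<close> depending on it.\<close>
    have bound: "\<exists>K>0. \<forall>n. cmod ((deriv ^^ n) f u) \<le> K * (B ^ n * fact n powr (1 - p))" if "B > 0" for B
      using root_sequence_bound[of p f u B] that order_tendstoD(2)[OF lim that]
      by (metis (mono_tags, lifting) eventually_mono less_imp_le)
    have "summable (\<lambda>n. (deriv ^^ n) f u * w ^ n / fact n)" for w
    proof -
      define B where "B = 1 / (cmod w + 1)"
      have "cmod w + 1 > 0" using norm_ge_zero[of w] by linarith
      then have B: "B > 0" "B * cmod w < 1"
        by (auto simp: B_def field_simps)
      obtain K where K: "K > 0" "\<And>n. cmod ((deriv ^^ n) f u) \<le> K * (B ^ n * fact n powr (1 - p))"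
        using bound[OF B(1)] by blast
      show ?thesis
      proof (rule summable_comparison_test)
        show "summable (\<lambda>n. K * (B * cmod w) ^ n)"
          using B by (intro summable_mult summable_geometric) auto
        show "\<exists>N. \<forall>n\<ge>N. norm ((deriv ^^ n) f u * w ^ n / fact n) \<le> K * (B * cmod w) ^ n"
        proof (intro exI allI impI)
          fix n
          \<comment> \<open>As \<open>p \<ge> 0\<close>, the full factorial dominates, and it
            cancels the Taylor denominator.\<close>
          have "fact n powr (1 - p) \<le> (fact n :: real)"
            using powr_mono[of "1 - p" 1 "fact n :: real"] p by simp
          then have "K * (B ^ n * fact n powr (1 - p)) \<le> K * (B ^ n * fact n)"
            using K B by (intro mult_left_mono) auto
          with K(2)[of n] have "cmod ((deriv ^^ n) f u) \<le> K * (B ^ n * fact n)" by linarith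
          then have "cmod ((deriv ^^ n) f u) * cmod w ^ n / fact n \<le> K * (B ^ n * fact n) * cmod w ^ n / fact n"
            by (intro divide_right_mono mult_right_mono) auto
          then show "norm ((deriv ^^ n) f u * w ^ n / fact n) \<le> K * (B * cmod w) ^ n"
            by (simp add: norm_mult norm_divide norm_power power_mult_distrib)
        qed
      qed
    qed
    note taylor = taylor_sums_on_connected[OF assms(4-7) this]
    \<comment> \<open>Here \<open>B\<close> is chosen after the radius. A general \<open>S\<close>
      serves both claims: a singleton gives pointwise convergence even when the surrounding disc
      leaves \<open>G\<close>, and a closed disc gives uniform convergence.\<close>
    have unif: "uniform_limit S ?S f sequentially" if "S \<subseteq> G" "S \<subseteq> cball u \<rho>" "\<rho> \<ge> 0" for S \<rho>
    proof -
      define B where "B = 1 / (16 * L\<^sup>2 * \<rho> + 1)"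
      have pos: "16 * L\<^sup>2 * \<rho> + 1 > 0" using that by (simp add: add_nonneg_pos)
      then have B: "B > 0" "16 * L\<^sup>2 * B * \<rho> < 1"
        by (auto simp: B_def field_simps)
      obtain K where K: "K > 0" "\<And>n. cmod ((deriv ^^ n) f u) \<le> K * (B ^ n * fact n powr (1 - p))"
        using bound[OF B(1)] by blast
      show ?thesis
        by (rule chromatic_expansion_uniform_limit[OF assms(3) B(1) K(1) that(3) K(2) B(2) that(2)])
          (use that taylor in auto)
    qed
    show "(\<lambda>k. chromatic_term P a f u k z) sums f z" if "z \<in> G" for z
      using tendsto_uniform_limitI[OF unif[of "{z}" "dist u z"], of z] that by (simp add: sums_def)
    show "uniform_limit (cball u \<rho>) ?S f sequentially" if "\<rho> > 0" "cball u \<rho> \<subseteq> G" for \<rho>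
      using unif[of "cball u \<rho>" \<rho>] that by simp
  }
qed

end
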